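(* Let $\mathcal{X}_0$ and $\mathcal{X}_{\mathrm{in}}$ be finite sets with $d_0=|\mathcal{X}_0|>1$, let $G$ be a graph on $\mathcal{X}_{\mathrm{in}}$, and let $\mathbb{K}$ be a field. Then the binomial edge ideal $I_G\subseteq\mathbb{K}[p_{ix}:i\in\mathcal{X}_0,x\in\mathcal{X}_{\mathrm{in}}]$ is a radical ideal.
   Context: Graphs are finite, undirected, and edges join distinct vertices; "a graph on $\mathcal{X}_{\mathrm{in}}$" has vertex set $\mathcal{X}_{\mathrm{in}}$. For $i,j\in\mathcal{X}_0$ and $x,y\in\mathcal{X}_{\mathrm{in}}$ let $f^{ij}_{xy}=p_{ix}p_{jy}-p_{iy}p_{jx}$ in $\mathfrak{R}=\mathbb{K}[p_{ix}:i\in\mathcal{X}_0,x\in\mathcal{X}_{\mathrm{in}}]$. The ($d_0$th) binomial edge ideal $I_G$ is the ideal of $\mathfrak{R}$ generated by all $f^{ij}_{xy}$ with $i,j\in\mathcal{X}_0$ and $(x,y)$ an edge of $G$. *)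

theory Defs
  imports
    "HOL-Algebra.Ideal"
    "HOL-Library.Poly_Mapping"
    "Graph_Theory.Pair_Digraph"
begin

text \<open>
  A polynomial with variables from a type \<open>'v\<close> and coefficients in \<open>'k\<close> is a finitely supported
  function from monomials to coefficients, where a monomial is a finitely supported exponent vector.
  The arithmetic on this type (convolution product) is that of \<^theory>\<open>HOL-Library.Poly_Mapping\<close>.
\<close>

type_synonym ('v, 'k) mpoly = "('v \<Rightarrow>\<^sub>0 nat) \<Rightarrow>\<^sub>0 'k"

text \<open>The polynomial ring \<open>\<KK>[v : v \<in> V]\<close> for a set \<open>V\<close> of variables and a coefficient field \<open>'k\<close>.\<close>

definition mpoly_ring :: "'v set \<Rightarrow> ('v, 'k::field) mpoly ring" where
  "mpoly_ring V =
    \<lparr> carrier = {q. \<forall>m \<in> Poly_Mapping.keys q. Poly_Mapping.keys m \<subseteq> V},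
      monoid.mult = (*), one = 1, ring.zero = 0, add = (+) \<rparr>"

lemma cring_mpoly_ring: "cring (mpoly_ring V :: ('v, 'k::field) mpoly ring)"
proof -
  define C where "C = {q :: ('v, 'k) mpoly. \<forall>m \<in> Poly_Mapping.keys q. Poly_Mapping.keys m \<subseteq> V}"
  have plus: "p + q \<in> C" if "p \<in> C" "q \<in> C" for p q
    using that Poly_Mapping.keys_add[of p q] unfolding C_def by blast
  have times: "p * q \<in> C" if "p \<in> C" "q \<in> C" for p q
  proof -
    have "Poly_Mapping.keys (a + b) \<subseteq> V" if "a \<in> Poly_Mapping.keys p" "b \<in> Poly_Mapping.keys q" for a b
      using that \<open>p \<in> C\<close> \<open>q \<in> C\<close> Poly_Mapping.keys_add[of a b] unfolding C_def by blast
    then show ?thesis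
      using Poly_Mapping.keys_mult[of p q] unfolding C_def by blast
  qed
  have uminus: "- p \<in> C" if "p \<in> C" for p
    using that by (simp add: C_def)
  have "\<exists>q\<in>C. q + p = 0" if "p \<in> C" for p
    using uminus[OF that] by (intro bexI[of _ "- p"]) auto
  moreover have "0 \<in> C" "1 \<in> C"
    by (auto simp: C_def)
  ultimately show ?thesis
    unfolding mpoly_ring_def C_def[symmetric]
    by (intro cringI abelian_groupI comm_monoidI)
       (auto simp: plus times algebra_simps)
qed

definition pvar :: "'i \<Rightarrow> 'x \<Rightarrow> ('i \<times> 'x, 'k::field) mpoly" where
  "pvar i x = Poly_Mapping.single (Poly_Mapping.single (i, x) 1) 1"

definition edge_binomial :: "'i \<Rightarrow> 'i \<Rightarrow> 'x \<Rightarrow> 'x \<Rightarrow> ('i \<times> 'x, 'k::field) mpoly" where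
  "edge_binomial i j x y = pvar i x * pvar j y - pvar i y * pvar j x"

text \<open>
  An undirected graph without loops is a symmetric loop-free arc relation (\<^locale>\<open>pair_graph\<close>); an edge
  between \<open>x\<close> and \<open>y\<close> is represented by the two arcs \<open>(x, y)\<close> and \<open>(y, x)\<close>.
\<close>

definition binomial_edge_ideal ::
    "'i set \<Rightarrow> 'x pair_pre_digraph \<Rightarrow> ('i \<times> 'x, 'k::field) mpoly set" where
  "binomial_edge_ideal X\<^sub>0 G =
    Idl\<^bsub>mpoly_ring (X\<^sub>0 \<times> pverts G)\<^esub>
      {edge_binomial i j x y | i j x y. i \<in> X\<^sub>0 \<and> j \<in> X\<^sub>0 \<and> (x, y) \<in> parcs G}"

definition ideal_radical :: "('a, 'b) ring_scheme \<Rightarrow> 'a set \<Rightarrow> 'a set" where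
  "ideal_radical R I = {a \<in> carrier R. \<exists>n::nat. n > 0 \<and> a [^]\<^bsub>R\<^esub> n \<in> I}"

definition radical_ideal :: "'a set \<Rightarrow> ('a, 'b) ring_scheme \<Rightarrow> bool" where
  "radical_ideal I R \<longleftrightarrow> ideal I R \<and> ideal_radical R I = I"

end

theory Submission
  imports Defs "HOL-Algebra.RingHom"
begin

text \<open>
  The ideal is generated by differences of two monomials, so it is governed by the equivalence
  relation on monomials that these differences generate. Read a monomial as a distribution of tokens:
  an exponent \<open>m (i, x)\<close> puts that many tokens of colour \<open>i\<close> on the vertex \<open>x\<close>. A generator then
  exchanges two tokens across an edge, and such an exchange changes neither the number of tokens on a
  vertex nor, for a connected component of the subgraph induced on the set \<open>W\<close> of occupied vertices,
  the number of tokens of a given colour on it. Conversely these numbers determine the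
  equivalence class. Every vertex of \<open>W\<close> carries a token, so two tokens in the same component can be
  exchanged by passing one of them along a walk (\<open>swaps_along_walk\<close>), and such exchanges bring any
  distribution to any other one with the same numbers (\<open>swaps_if_same_degrees\<close>).

  The invariants are the exponents of a monomial parametrization. For a set \<open>W\<close> of vertices let
  \<open>\<phi>\<^sub>W\<close> send the variable \<open>p\<^sub>i\<^sub>x\<close> to \<open>a\<^sub>C\<^sub>i b\<^sub>x\<close> if \<open>x \<in> W\<close> lies in the component \<open>C\<close> of the graph
  induced on \<open>W\<close>, and to \<open>0\<close> if \<open>x \<notin> W\<close>. Each \<open>\<phi>\<^sub>W\<close> is a ring homomorphism into a polynomial ring
  that kills the generators (\<open>parametrize_ideal\<close>). If a nonzero \<open>f\<close> is killed by all of them, take a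
  monomial \<open>m\<close> of \<open>f\<close> and let \<open>W\<close> be the set of its occupied vertices. The coefficient
  of \<open>\<phi>\<^sub>W m\<close> in \<open>\<phi>\<^sub>W f\<close> vanishes, so \<open>f\<close> has another monomial with the same image, hence equivalent to
  \<open>m\<close>, and subtracting a multiple of their difference removes \<open>m\<close> from \<open>f\<close>. So the ideal is
  exactly the intersection of the kernels of the \<open>\<phi>\<^sub>W\<close> (\<open>ideal_if_parametrize\<close>). As polynomial rings
  over a field are reduced (\<open>power_eq_0_imp_mpoly_eq_0\<close>), each kernel is radical, and so is
  their intersection.
\<close>

section \<open>Linear extension of partial maps on monomials\<close>

text \<open>
  Applied to polynomials, this is the linear map that sends a monomial \<open>m\<close> to \<open>t m\<close> or, when
  \<open>P m\<close> fails, to \<open>0\<close>. Applied to exponent vectors with \<open>P\<close> always true, it is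
  the renaming of variables along \<open>t\<close>, where exponents of identified variables add up.
\<close>

definition push :: "('a \<Rightarrow> bool) \<Rightarrow> ('a \<Rightarrow> 'b) \<Rightarrow> ('a \<Rightarrow>\<^sub>0 'c::comm_monoid_add) \<Rightarrow> ('b \<Rightarrow>\<^sub>0 'c)" where
  "push P t f = (\<Sum>m \<in> Poly_Mapping.keys f.
     if P m then Poly_Mapping.single (t m) (Poly_Mapping.lookup f m) else 0)"

lemma push_add: "push P t (f + g) = push P t f + push P t g"
  unfolding push_def
  by (rule setsum_keys_plus_distrib[where f = "\<lambda>m c. if P m then Poly_Mapping.single (t m) c else 0"])
    (auto simp: single_add)

lemma push_zero [simp]: "push P t 0 = 0"
  by (simp add: push_def)

lemma push_sum: "push P t (sum f A) = (\<Sum>a\<in>A. push P t (f a))"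
  by (induction A rule: infinite_finite_induct) (auto simp: push_add)

lemma push_diff: "push P t (f - g) = push P t f - push P t (g :: 'a \<Rightarrow>\<^sub>0 'c::ab_group_add)"
  using push_add[of P t "f - g" g] by (simp only: diff_add_cancel eq_diff_eq)

lemma push_single [simp]:
  "push P t (Poly_Mapping.single m c) = (if P m then Poly_Mapping.single (t m) c else 0)"
  by (simp add: push_def)

lemma lookup_push:
  assumes "finite A" and "Poly_Mapping.keys f \<subseteq> A"
  shows "Poly_Mapping.lookup (push P t f) s = (\<Sum>m \<in> {m\<in>A. P m \<and> t m = s}. Poly_Mapping.lookup f m)"
proof -
  have "Poly_Mapping.lookup (push P t f) s
      = (\<Sum>m \<in> Poly_Mapping.keys f. if P m \<and> t m = s then Poly_Mapping.lookup f m else 0)"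
    unfolding push_def lookup_sum by (rule sum.cong) (auto simp: lookup_single)
  also have "\<dots> = (\<Sum>m \<in> A. if P m \<and> t m = s then Poly_Mapping.lookup f m else 0)"
    using assms by (intro sum.mono_neutral_left) (auto simp: in_keys_iff)
  also have "\<dots> = (\<Sum>m \<in> {m\<in>A. P m \<and> t m = s}. Poly_Mapping.lookup f m)"
    using assms(1) by (rule sum.inter_filter[symmetric])
  finally show ?thesis .
qed

lemma sum_singles: "(\<Sum>m\<in>Poly_Mapping.keys f. Poly_Mapping.single m (Poly_Mapping.lookup f m)) = f"
  by (rule poly_mapping_eqI) (simp add: lookup_sum lookup_single when_def not_in_keys_iff_lookup_eq_zero)

text \<open>
  If \<open>t\<close> is additive and the monomials satisfying \<open>P\<close> are closed under products and factors, then
  \<open>push P t\<close> is a ring homomorphism: by bilinearity it is enough to compare products of two monomials.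
\<close>

lemma push_mult:
  fixes f g :: "'a::monoid_add \<Rightarrow>\<^sub>0 'c::semiring_0" and t :: "'a \<Rightarrow> 'b::monoid_add"
  assumes P: "\<And>m n. P (m + n) \<longleftrightarrow> P m \<and> P n" and t: "\<And>m n. t (m + n) = t m + t n"
  shows "push P t (f * g) = push P t f * push P t g"
proof -
  let ?s = "\<lambda>f m. Poly_Mapping.single m (Poly_Mapping.lookup f m)"
  have "push P t (f * g) = push P t ((\<Sum>m\<in>Poly_Mapping.keys f. ?s f m) * (\<Sum>n\<in>Poly_Mapping.keys g. ?s g n))"
    by (simp only: sum_singles)
  also have "\<dots> = (\<Sum>m\<in>Poly_Mapping.keys f. \<Sum>n\<in>Poly_Mapping.keys g. push P t (?s f m) * push P t (?s g n))"
    unfolding sum_product push_sum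
    by (intro sum.cong refl) (auto simp: mult_single P t)
  also have "\<dots> = push P t f * push P t g"
    unfolding sum_product[symmetric] push_sum[symmetric] sum_singles ..
  finally show ?thesis .
qed

lemma push_one:
  fixes t :: "'a::monoid_add \<Rightarrow> 'b::monoid_add"
  assumes "P 0" and "t 0 = 0"
  shows "push P t (1 :: 'a \<Rightarrow>\<^sub>0 'c::semiring_1) = 1"
  using push_single[of P t 0 "1::'c"] assms by simp

lemma push_power:
  fixes f :: "'a::monoid_add \<Rightarrow>\<^sub>0 'c::semiring_1" and t :: "'a \<Rightarrow> 'b::monoid_add"
  assumes "\<And>m n. P (m + n) \<longleftrightarrow> P m \<and> P n" and "\<And>m n. t (m + n) = t m + t n"
    and "P 0" and "t 0 = 0"
  shows "push P t (f ^ n) = push P t f ^ n"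
  by (induction n) (auto simp: push_one push_mult assms)

section \<open>Reduced polynomial rings and radical kernels\<close>

abbreviation rename :: "('v \<Rightarrow> 'w) \<Rightarrow> ('v \<Rightarrow>\<^sub>0 nat) \<Rightarrow> ('w \<Rightarrow>\<^sub>0 nat)" where
  "rename \<equiv> push (\<lambda>_. True)"

text \<open>
  When the variables are linearly ordered, so are the monomials, and leading terms show that there
  are no zero divisors. The finitely many variables that occur in \<open>g\<close> can be numbered, and a
  renaming that is injective on them keeps every coefficient of \<open>g\<close>.
\<close>

lemma power_eq_0_imp_mpoly_eq_0:
  fixes g :: "('v, 'k::field) mpoly"
  assumes "g ^ n = 0"
  shows "g = 0"
proof -
  define V where "V = (\<Union>m\<in>Poly_Mapping.keys g. Poly_Mapping.keys m)"
  have "finite V"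
    by (simp add: V_def)
  then obtain e :: "'v \<Rightarrow> nat" where e: "inj_on e V"
    using finite_imp_inj_to_nat_seg[of V] by auto
  have rename_e: "Poly_Mapping.lookup (rename e m) (e v) = Poly_Mapping.lookup m v"
    if "Poly_Mapping.keys m \<subseteq> V" "v \<in> V" for m v
  proof -
    have "{w\<in>V. True \<and> e w = e v} = {v}"
      using e that(2) by (auto dest: inj_onD)
    then show ?thesis
      using lookup_push[OF \<open>finite V\<close> that(1), of "\<lambda>_. True" e "e v"] by simp
  qed
  have inj: "m = m'" if "rename e m = rename e m'" "Poly_Mapping.keys m \<subseteq> V" "Poly_Mapping.keys m' \<subseteq> V" for m m'
  proof (rule poly_mapping_eqI)
    fix v
    show "Poly_Mapping.lookup m v = Poly_Mapping.lookup m' v"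
    proof (cases "v \<in> V")
      case True
      then show ?thesis
        using rename_e that by metis
    next
      case False
      then show ?thesis
        using that(2,3) by (metis in_keys_iff subsetD)
    qed
  qed
  have "push (\<lambda>_. True) (rename e) g ^ n = 0"
    using push_power[of "\<lambda>_. True" "rename e" g n] assms by (simp add: push_add)
  then have zero: "push (\<lambda>_. True) (rename e) g = 0"
    by simp
  show ?thesis
  proof (rule poly_mapping_eqI, rule ccontr)
    fix m
    assume "Poly_Mapping.lookup g m \<noteq> Poly_Mapping.lookup 0 m"
    then have m: "m \<in> Poly_Mapping.keys g"
      by (simp add: in_keys_iff)
    have "{m' \<in> Poly_Mapping.keys g. True \<and> rename e m' = rename e m} = {m}"
      using m by (auto intro!: inj simp: V_def)
    then have "Poly_Mapping.lookup g m = 0"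
      using lookup_push[of "Poly_Mapping.keys g" g "\<lambda>_. True" "rename e" "rename e m"] zero by simp
    with m show False
      by (simp add: in_keys_iff)
  qed
qed

lemma ideal_kernel_push:
  fixes t :: "('v \<Rightarrow>\<^sub>0 nat) \<Rightarrow> ('w \<Rightarrow>\<^sub>0 nat)"
  assumes "\<And>m n. P (m + n) \<longleftrightarrow> P m \<and> P n" and "\<And>m n. t (m + n) = t m + t n"
    and "P 0" and "t 0 = 0"
  shows "ideal {f \<in> carrier (mpoly_ring A). push P t f = 0} (mpoly_ring A :: ('v, 'k::field) mpoly ring)"
proof -
  let ?S = "mpoly_ring UNIV :: ('w, 'k) mpoly ring"
  let ?A = "mpoly_ring A :: ('v, 'k) mpoly ring"
  have mult: "push P t (f * g) = push P t f * push P t g" for f g :: "('v, 'k) mpoly"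
    using assms(1,2) by (rule push_mult)
  have one: "push P t (1 :: ('v, 'k) mpoly) = 1"
    using assms(3,4) by (rule push_one)
  have "push P t \<in> ring_hom ?A ?S"
    by (rule ring_hom_memI) (simp_all add: mpoly_ring_def push_add mult one)
  then have "ring_hom_ring ?A ?S (push P t)"
    by (intro ring_hom_ringI2 cring.axioms(1) cring_mpoly_ring)
  from ring_hom_ring.kernel_is_ideal[OF this] show ?thesis
    by (simp add: a_kernel_def' mpoly_ring_def)
qed

section \<open>Exchanging tokens on a graph\<close>

abbreviation columns :: "('i \<times> 'x \<Rightarrow>\<^sub>0 nat) \<Rightarrow> 'x set" where
  "columns m \<equiv> snd ` Poly_Mapping.keys m"

lemma keys_add_nat: "Poly_Mapping.keys (m + n :: 'v \<Rightarrow>\<^sub>0 nat) = Poly_Mapping.keys m \<union> Poly_Mapping.keys n"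
  by (auto simp: in_keys_iff lookup_add)

text \<open>
  The two exponent vectors have the same sum over each fibre of \<open>u\<close>, so a surplus at \<open>v\<close> is made up
  for elsewhere in the fibre of \<open>v\<close>.
\<close>

lemma fibre_deficit:
  fixes m n :: "'v \<Rightarrow>\<^sub>0 nat"
  assumes "rename u m = rename u n" and "Poly_Mapping.lookup n v < Poly_Mapping.lookup m v"
  obtains w where "u w = u v" and "Poly_Mapping.lookup m w < Poly_Mapping.lookup n w"
proof -
  let ?A = "Poly_Mapping.keys m \<union> Poly_Mapping.keys n"
  let ?F = "{w\<in>?A. True \<and> u w = u v}"
  have "v \<in> ?F"
    using assms(2) by (auto simp: in_keys_iff)
  have "(\<Sum>w\<in>?F. Poly_Mapping.lookup m w) = (\<Sum>w\<in>?F. Poly_Mapping.lookup n w)"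
    using assms(1) lookup_push[of ?A m "\<lambda>_. True" u "u v"] lookup_push[of ?A n "\<lambda>_. True" u "u v"] by simp
  moreover have "(\<Sum>w\<in>?F. Poly_Mapping.lookup n w) < (\<Sum>w\<in>?F. Poly_Mapping.lookup m w)"
    if "\<And>w. u w = u v \<Longrightarrow> Poly_Mapping.lookup n w \<le> Poly_Mapping.lookup m w"
    using that assms(2) \<open>v \<in> ?F\<close> by (intro sum_strict_mono_ex1) auto
  ultimately have "\<not> (\<forall>w. u w = u v \<longrightarrow> Poly_Mapping.lookup n w \<le> Poly_Mapping.lookup m w)"
    by (metis (no_types, lifting) less_irrefl)
  then show thesis
    using that by (auto simp: not_le)
qed

locale binomial_edge_setup =
  fixes X\<^sub>0 :: "'i set" and G :: "'x pair_pre_digraph"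
  assumes finite_rows: "finite X\<^sub>0" and graph: "pair_graph G"
begin

sublocale pair_graph G by (rule graph)

abbreviation tok :: "'i \<Rightarrow> 'x \<Rightarrow> ('i \<times> 'x \<Rightarrow>\<^sub>0 nat)" where
  "tok i x \<equiv> Poly_Mapping.single (i, x) 1"

abbreviation monomials :: "('i \<times> 'x \<Rightarrow>\<^sub>0 nat) set" where
  "monomials \<equiv> {m. Poly_Mapping.keys m \<subseteq> X\<^sub>0 \<times> pverts G}"

abbreviation edges_in :: "'x set \<Rightarrow> ('x \<times> 'x) set" where
  "edges_in W \<equiv> parcs G \<inter> W \<times> W"

definition component :: "'x set \<Rightarrow> 'x \<Rightarrow> 'x set" where
  "component W x = {y. (x, y) \<in> (edges_in W)\<^sup>*}"

text \<open>A component is defined by one-way reachability; each arc has a reverse arc, so both ends reach the same vertices.\<close>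

lemma component_edge:
  assumes "(x, y) \<in> edges_in W"
  shows "component W x = component W y"
proof -
  have "(y, x) \<in> edges_in W"
    using assms pair_sym_arcs by (auto simp: symmetric_def sym_def)
  with assms show ?thesis
    unfolding component_def by (auto intro: converse_rtrancl_into_rtrancl)
qed

inductive swaps :: "('i \<times> 'x \<Rightarrow>\<^sub>0 nat) \<Rightarrow> ('i \<times> 'x \<Rightarrow>\<^sub>0 nat) \<Rightarrow> bool" where
  refl: "swaps m m"
| swap: "swaps (tok i x + tok j y + r) (tok i y + tok j x + r)"
    if "(x, y) \<in> parcs G" "i \<in> X\<^sub>0" "j \<in> X\<^sub>0" "r \<in> monomials"
| trans [trans]: "swaps m n \<Longrightarrow> swaps n s \<Longrightarrow> swaps m s"

text \<open>
  Two tokens can trade places along a walk as a transposition is a product of transpositions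
  of neighbours. Moving a token across an edge requires another one to move back; this is why each
  vertex of \<open>W\<close> must be occupied.
\<close>

lemma swaps_along_walk:
  assumes "(x, y) \<in> (edges_in W)\<^sup>*" and "x \<in> W" and "W \<subseteq> pverts G"
    and "i \<in> X\<^sub>0" and "j \<in> X\<^sub>0" and "r \<in> monomials" and "W \<subseteq> columns (tok i x + tok j y + r)"
  shows "swaps (tok i x + tok j y + r) (tok i y + tok j x + r)"
  using assms(1,4-)
proof (induction arbitrary: i j r rule: rtrancl_induct)
  case base
  then show ?case by (simp add: swaps.refl)
next
  case (step y z)
  have yz: "(y, z) \<in> parcs G" "y \<in> W" "z \<in> W"
    using step.hyps(2) by auto
  consider "x = z" | "x = y" | "x \<noteq> z" "x \<noteq> y" "y \<noteq> z"
    using pair_no_loops[OF yz(1)] by auto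
  then show ?case
  proof cases
    case 1
    then show ?thesis by (simp add: swaps.refl add.commute)
  next
    case 2
    with swaps.swap[OF yz(1) step.prems(1-3)] show ?thesis by simp
  next
    case 3
    then have "y \<in> columns r"
      using step.prems(4) yz(2) by (auto simp: keys_add_nat)
    (* k is the colour of an auxiliary token on y, the last vertex before z: it trades places with the
       token on z, then the tokens on x and y trade places, then k returns from z to y. *)
    then obtain k where k: "(k, y) \<in> Poly_Mapping.keys r"
      by auto
    define r' where "r' = r - tok k y"
    have r: "r = tok k y + r'"
      using k unfolding r'_def
      by (intro poly_mapping_eqI) (auto simp: lookup_add lookup_minus lookup_single in_keys_iff when_def)
    have mono: "k \<in> X\<^sub>0" "r' \<in> monomials" "tok i x + r' \<in> monomials" "tok k z + r' \<in> monomials"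
        "tok j x + r' \<in> monomials"
      using k step.prems(1-3) assms(2,3) yz(2,3) unfolding r by (auto simp: keys_add_nat)
    have "swaps (tok k y + tok j z + (tok i x + r')) (tok k z + tok j y + (tok i x + r'))"
      using yz(1) mono step.prems by (intro swaps.swap) auto
    also have "tok k z + tok j y + (tok i x + r') = tok i x + tok j y + (tok k z + r')"
      by (simp only: ac_simps)
    also have "swaps \<dots> (tok i y + tok j x + (tok k z + r'))"
      using step.prems mono unfolding r by (intro step.IH) (auto simp: keys_add_nat)
    also have "tok i y + tok j x + (tok k z + r') = tok i y + tok k z + (tok j x + r')"
      by (simp only: ac_simps)
    also have "swaps \<dots> (tok i z + tok k y + (tok j x + r'))"
      using yz(1) mono step.prems by (intro swaps.swap) auto
    finally show ?thesis
      unfolding r by (simp only: ac_simps)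
  qed
qed

text \<open>
  As long as \<open>m \<noteq> n\<close>, a single exchange within a component brings \<open>m\<close> closer to \<open>n\<close>. Some vertex \<open>x\<close>
  has too many tokens of some colour \<open>i\<close>; some vertex \<open>y\<close> of its component has too few of them, and
  then too many of another colour \<open>j\<close>, because \<open>y\<close> holds the right number of tokens altogether.
  Exchange the \<open>i\<close> on \<open>x\<close> with the \<open>j\<close> on \<open>y\<close>.
\<close>

lemma swaps_if_same_degrees:
  assumes "m \<in> monomials" and "n \<in> monomials"
    and "rename (\<lambda>(i, x). (component (columns m) x, i)) m = rename (\<lambda>(i, x). (component (columns m) x, i)) n"
    and "rename snd m = rename snd n"
  shows "swaps m n"
proof -
  define W where "W = columns m"
  let ?c = "\<lambda>(i, x). (component W x, i :: 'i)"
  let ?V = "X\<^sub>0 \<times> pverts G"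
  let ?l = Poly_Mapping.lookup
  have finV: "finite ?V"
    using finite_rows pair_finite_verts by simp
  have W: "W \<subseteq> pverts G"
    using assms(1) by (auto simp: W_def)
  have "m \<in> monomials \<Longrightarrow> columns m = W \<Longrightarrow> rename ?c m = rename ?c n \<Longrightarrow> rename snd m = rename snd n
      \<Longrightarrow> swaps m n"
  proof (induction "\<Sum>v\<in>?V. ?l m v - ?l n v" arbitrary: m rule: less_induct)
    case less
    show ?case
    proof (cases "m = n")
      case True
      then show ?thesis by (simp add: swaps.refl)
    next
      case False
      then obtain v where "?l m v \<noteq> ?l n v"
        by (meson poly_mapping_eqI)
      then obtain i x where ix: "?l n (i, x) < ?l m (i, x)"
        using fibre_deficit[OF less.prems(4)[symmetric]] by (metis nat_neq_iff surj_pair)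
      obtain y where y: "component W y = component W x" "?l m (i, y) < ?l n (i, y)"
        using fibre_deficit[OF less.prems(3) ix] by auto
      obtain j where j: "?l n (j, y) < ?l m (j, y)"
        using fibre_deficit[OF less.prems(4)[symmetric] y(2)] by (metis prod.collapse snd_conv)
      have ne: "i \<noteq> j" "x \<noteq> y"
        using ix y j by auto
      have keys: "(i, x) \<in> Poly_Mapping.keys m" "(j, y) \<in> Poly_Mapping.keys m"
        using ix j by (auto simp: in_keys_iff)
      then have mem: "i \<in> X\<^sub>0" "j \<in> X\<^sub>0" "x \<in> W" "y \<in> W" "x \<in> pverts G" "y \<in> pverts G"
        using less.prems(1,2) by (auto intro: rev_image_eqI)
      define r where "r = m - (tok i x + tok j y)"
      have m: "m = tok i x + tok j y + r"
        using keys ne unfolding r_def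
        by (intro poly_mapping_eqI) (auto simp: lookup_add lookup_minus lookup_single in_keys_iff when_def)
      have r: "r \<in> monomials"
        using less.prems(1) unfolding m by (auto simp: keys_add_nat)
      define m' where "m' = tok i y + tok j x + r"
      have "(x, y) \<in> (edges_in W)\<^sup>*"
        using y(1) by (auto simp: component_def)
      then have mm': "swaps m m'"
        using mem W r less.prems(2) unfolding m m'_def by (intro swaps_along_walk) auto
      have "swaps m' n"
      proof (rule less.hyps)
        (* The total surplus drops: it loses one unit at (i, x) and one at (j, y), and may regain one
           only at (j, x); the new token at (i, y) fills a deficit. *)
        have "?l m' v - ?l n v + (if v = (i, x) then 1 else 0) + (if v = (j, y) then 1 else 0)
            \<le> ?l m v - ?l n v + (if v = (j, x) then 1 else 0)" for v
          using ix y(2) j ne unfolding m m'_def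
          by (auto simp: lookup_add lookup_single when_def)
        then have "(\<Sum>v\<in>?V. ?l m' v - ?l n v + (if v = (i, x) then 1 else 0) + (if v = (j, y) then 1 else 0))
            \<le> (\<Sum>v\<in>?V. ?l m v - ?l n v + (if v = (j, x) then 1 else 0))"
          by (intro sum_mono)
        then show "(\<Sum>v\<in>?V. ?l m' v - ?l n v) < (\<Sum>v\<in>?V. ?l m v - ?l n v)"
          using finV mem by (simp add: sum.distrib)
        show "m' \<in> monomials"
          using r mem unfolding m'_def by (auto simp: keys_add_nat)
        show "columns m' = W"
          using less.prems(2) unfolding m m'_def by (auto simp: keys_add_nat)
        show "rename ?c m' = rename ?c n"
          using less.prems(3) y(1) unfolding m m'_def by (simp add: push_add ac_simps)
        show "rename snd m' = rename snd n"
          using less.prems(4) unfolding m m'_def by (simp add: push_add ac_simps)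
      qed
      with mm' show ?thesis by (rule swaps.trans)
    qed
  qed
  then show ?thesis
    using assms by (simp add: W_def)
qed

section \<open>The binomial edge ideal as an intersection of kernels\<close>

abbreviation R :: "('i \<times> 'x, 'k::field) mpoly ring" where
  "R \<equiv> mpoly_ring (X\<^sub>0 \<times> pverts G)"

abbreviation I :: "('i \<times> 'x, 'k::field) mpoly set" where
  "I \<equiv> binomial_edge_ideal X\<^sub>0 G"

lemma carrier_R: "f \<in> carrier R \<longleftrightarrow> Poly_Mapping.keys f \<subseteq> monomials"
  by (auto simp: mpoly_ring_def)

lemma generators_in_carrier:
  "{edge_binomial i j x y | i j x y. i \<in> X\<^sub>0 \<and> j \<in> X\<^sub>0 \<and> (x, y) \<in> parcs G}
    \<subseteq> (carrier R :: ('i \<times> 'x, 'k::field) mpoly set)"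
proof -
  have "edge_binomial i j x y \<in> (carrier R :: ('i \<times> 'x, 'k) mpoly set)"
    if "i \<in> X\<^sub>0" "j \<in> X\<^sub>0" "(x, y) \<in> parcs G" for i j x y
  proof -
    have "x \<in> pverts G" "y \<in> pverts G"
      using arc_fst_in_verts arc_snd_in_verts that(3) by fastforce+
    with that show ?thesis
      unfolding carrier_R edge_binomial_def pvar_def mult_single
      by (intro order.trans[OF keys_diff]) (auto simp: keys_add_nat)
  qed
  then show ?thesis by blast
qed

lemma ideal_I: "ideal I (R :: ('i \<times> 'x, 'k::field) mpoly ring)"
  unfolding binomial_edge_ideal_def
  by (intro ring.genideal_ideal cring.axioms(1) cring_mpoly_ring generators_in_carrier)

lemma I_add: "f \<in> I \<Longrightarrow> g \<in> I \<Longrightarrow> f + g \<in> (I :: ('i \<times> 'x, 'k::field) mpoly set)"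
  using additive_subgroup.a_closed[OF ideal.axioms(1)[OF ideal_I], of f g]
  by (simp add: mpoly_ring_def)

lemma I_mult: "f \<in> I \<Longrightarrow> g \<in> carrier R \<Longrightarrow> g * f \<in> (I :: ('i \<times> 'x, 'k::field) mpoly set)"
  using ideal.I_l_closed[OF ideal_I, of f g] by (simp add: mpoly_ring_def)

lemma I_zero: "0 \<in> (I :: ('i \<times> 'x, 'k::field) mpoly set)"
  using additive_subgroup.zero_closed[OF ideal.axioms(1)[OF ideal_I]]
  by (simp add: mpoly_ring_def)

text \<open>An exchange across an edge changes a monomial by a monomial multiple of a generator.\<close>

lemma swaps_in_ideal:
  assumes "swaps m n"
  shows "Poly_Mapping.single m c - Poly_Mapping.single n c \<in> (I :: ('i \<times> 'x, 'k::field) mpoly set)"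
  using assms
proof induction
  case (refl m)
  then show ?case by (simp add: I_zero)
next
  case (swap x y i j r)
  have "Poly_Mapping.single (tok i x + tok j y + r) c - Poly_Mapping.single (tok i y + tok j x + r) c
      = Poly_Mapping.single r c * edge_binomial i j x y"
    by (simp add: edge_binomial_def pvar_def mult_single right_diff_distrib ac_simps)
  moreover have "edge_binomial i j x y \<in> (I :: ('i \<times> 'x, 'k) mpoly set)"
    using swap ring.genideal_self[OF cring.axioms(1)[OF cring_mpoly_ring] generators_in_carrier]
    unfolding binomial_edge_ideal_def by blast
  ultimately show ?case
    using swap(4) by (auto intro!: I_mult simp: carrier_R)
next
  case (trans m n s)
  then show ?case using I_add by fastforce
qed

text \<open>
  The exponent vector of the image of the monomial \<open>m\<close> under the parametrization
  \<open>p\<^sub>i\<^sub>x \<mapsto> a\<^sub>C\<^sub>i b\<^sub>x\<close>: the left summand of the index type holds the variables \<open>a\<^sub>C\<^sub>i\<close> and the right one the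
  variables \<open>b\<^sub>x\<close>.
\<close>

definition signature :: "'x set \<Rightarrow> ('i \<times> 'x \<Rightarrow>\<^sub>0 nat) \<Rightarrow> (('x set \<times> 'i) + 'x \<Rightarrow>\<^sub>0 nat)" where
  "signature W m = rename (\<lambda>(i, x). Inl (component W x, i)) m + rename (\<lambda>v. Inr (snd v)) m"

abbreviation parametrize :: "'x set \<Rightarrow> ('i \<times> 'x, 'k::field) mpoly \<Rightarrow> (('x set \<times> 'i) + 'x, 'k) mpoly" where
  "parametrize W \<equiv> push (\<lambda>m. columns m \<subseteq> W) (signature W)"

lemma signature_add: "signature W (m + n) = signature W m + signature W n"
  by (simp add: signature_def push_add ac_simps)

lemma signature_zero: "signature W 0 = 0"
  by (simp add: signature_def)

lemma signature_eqD:
  assumes "signature W m = signature W n"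
  shows "rename (\<lambda>(i, x). (component W x, i)) m = rename (\<lambda>(i, x). (component W x, i)) n"
    and "rename snd m = rename snd n"
proof -
  have l: "Poly_Mapping.lookup (signature W m) (Inl t) = Poly_Mapping.lookup (rename (\<lambda>(i, x). (component W x, i)) m) t"
    for t m
    by (simp add: signature_def lookup_add lookup_push[OF finite_keys order_refl] case_prod_unfold)
  have r: "Poly_Mapping.lookup (signature W m) (Inr t) = Poly_Mapping.lookup (rename snd m) t" for t m
    by (simp add: signature_def lookup_add lookup_push[OF finite_keys order_refl] case_prod_unfold)
  show "rename (\<lambda>(i, x). (component W x, i)) m = rename (\<lambda>(i, x). (component W x, i)) n"
    and "rename snd m = rename snd n"
    using assms by (auto intro!: poly_mapping_eqI simp flip: l r)
qed

lemma parametrize_power: "parametrize W (f ^ n) = parametrize W f ^ n"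
  by (intro push_power) (auto simp: keys_add_nat signature_add signature_zero)

text \<open>
  Let \<open>(x, y)\<close> be an edge. If both ends are in \<open>W\<close>, they lie in the same component and the two monomials
  of the binomial have the same image; otherwise both monomials go to \<open>0\<close>, as each of them involves
  both columns.
\<close>

lemma parametrize_ideal:
  assumes "f \<in> I"
  shows "parametrize W f = 0"
proof -
  let ?K = "{f \<in> carrier R. parametrize W f = 0}"
  have "ideal ?K R"
    by (intro ideal_kernel_push) (auto simp: keys_add_nat signature_add signature_zero)
  moreover have "{edge_binomial i j x y | i j x y. i \<in> X\<^sub>0 \<and> j \<in> X\<^sub>0 \<and> (x, y) \<in> parcs G} \<subseteq> ?K"
  proof -
    have "parametrize W (edge_binomial i j x y) = 0" if "(x, y) \<in> parcs G" for i j x y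
    proof (cases "x \<in> W \<and> y \<in> W")
      case True
      then have "component W x = component W y"
        using that by (intro component_edge) auto
      then show ?thesis
        by (auto simp: edge_binomial_def pvar_def mult_single push_diff keys_add_nat signature_def
            push_add ac_simps)
    next
      case False
      then show ?thesis
        by (auto simp: edge_binomial_def pvar_def mult_single push_diff keys_add_nat)
    qed
    with generators_in_carrier show ?thesis by blast
  qed
  ultimately show ?thesis
    using assms ring.genideal_minimal[OF cring.axioms(1)[OF cring_mpoly_ring], of ?K]
    unfolding binomial_edge_ideal_def by blast
qed

text \<open>
  The choice of \<open>W\<close> as the exact set of columns of a monomial \<open>m\<close> of \<open>f\<close> makes \<open>W\<close>-components the
  ones for which \<open>swaps_if_same_degrees\<close> applies to \<open>m\<close>. The polynomial \<open>f\<close> loses a monomial in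
  each step of the induction, and it stays in all kernels because they contain the ideal.
\<close>

lemma ideal_if_parametrize:
  fixes f :: "('i \<times> 'x, 'k::field) mpoly"
  assumes "f \<in> carrier R" and "\<And>W. parametrize W f = 0"
  shows "f \<in> I"
  using assms
proof (induction "card (Poly_Mapping.keys f)" arbitrary: f rule: less_induct)
  case less
  show ?case
  proof (cases "f = 0")
    case True
    then show ?thesis by (simp add: I_zero)
  next
    case False
    then obtain m where m: "m \<in> Poly_Mapping.keys f"
      by (metis all_not_in_conv keys_eq_empty)
    define c where "c = Poly_Mapping.lookup f m"
    define W where "W = columns m"
    have "c \<noteq> 0"
      using m by (simp add: c_def in_keys_iff)
    (* Otherwise the coefficient c of m would survive in the parametrization, where nothing cancels it. *)
    have "\<exists>n\<in>Poly_Mapping.keys f. n \<noteq> m \<and> signature W n = signature W m"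
    proof (rule ccontr)
      assume "\<not> ?thesis"
      then have "{n \<in> Poly_Mapping.keys f. columns n \<subseteq> W \<and> signature W n = signature W m} = {m}"
        using m by (auto simp: W_def)
      with \<open>c \<noteq> 0\<close> show False
        using less.prems(2)[of W] lookup_push[OF finite_keys order_refl, of "\<lambda>m. columns m \<subseteq> W" "signature W" f "signature W m"]
        by (simp add: c_def)
    qed
    then obtain n where n: "n \<in> Poly_Mapping.keys f" "n \<noteq> m" "signature W m = signature W n"
      by metis
    have "swaps m n"
      using m n(1) less.prems(1) signature_eqD[OF n(3)]
      unfolding carrier_R W_def by (intro swaps_if_same_degrees) auto
    define b where "b = Poly_Mapping.single m c - Poly_Mapping.single n c"
    have b: "b \<in> I"
      using swaps_in_ideal[OF \<open>swaps m n\<close>] by (simp add: b_def)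
    have sub: "Poly_Mapping.keys (f - b) \<subset> Poly_Mapping.keys f"
    proof -
      have "Poly_Mapping.keys (f - b) \<subseteq> Poly_Mapping.keys f"
        using m n(1) by (auto simp: b_def in_keys_iff lookup_minus lookup_single when_def split: if_splits)
      moreover have "m \<notin> Poly_Mapping.keys (f - b)"
        using n(2) by (simp add: b_def c_def in_keys_iff lookup_minus lookup_single)
      ultimately show ?thesis
        using m by blast
    qed
    have "f - b \<in> I"
    proof (rule less.hyps)
      show "card (Poly_Mapping.keys (f - b)) < card (Poly_Mapping.keys f)"
        using sub by (intro psubset_card_mono) auto
      show "f - b \<in> carrier R"
        using sub less.prems(1) unfolding carrier_R by blast
      show "parametrize W (f - b) = 0" for W
        using less.prems(2) parametrize_ideal[OF b] by (simp add: push_diff)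
    qed
    with b show ?thesis
      using I_add by fastforce
  qed
qed

lemma R_pow: "f [^]\<^bsub>R\<^esub> (n::nat) = (f ^ n :: ('i \<times> 'x, 'k::field) mpoly)"
proof -
  interpret cring "R :: ('i \<times> 'x, 'k) mpoly ring" by (rule cring_mpoly_ring)
  show ?thesis
    by (induction n) (simp_all add: mpoly_ring_def nat_pow_def mult.commute)
qed

end

theorem corollary4:
  fixes X\<^sub>0 :: "'i set" and X\<^sub>i\<^sub>n :: "'x set" and G :: "'x pair_pre_digraph"
  assumes "finite X\<^sub>0" and "finite X\<^sub>i\<^sub>n" and "card X\<^sub>0 > 1"
    and "pair_graph G" and "pverts G = X\<^sub>i\<^sub>n"
  shows "radical_ideal (binomial_edge_ideal X\<^sub>0 G)
           (mpoly_ring (X\<^sub>0 \<times> X\<^sub>i\<^sub>n) :: ('i \<times> 'x, 'k::field) mpoly ring)"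
proof -
  interpret binomial_edge_setup X\<^sub>0 G
    using assms by (intro binomial_edge_setup.intro)
  let ?R = "R :: ('i \<times> 'x, 'k) mpoly ring"
  have "f \<in> I" if "f \<in> carrier ?R" "f [^]\<^bsub>?R\<^esub> (n::nat) \<in> I" for f n
  proof (rule ideal_if_parametrize[OF that(1)])
    fix W
    have "parametrize W f ^ n = 0"
      using parametrize_ideal[OF that(2)[unfolded R_pow]] by (simp add: parametrize_power)
    then show "parametrize W f = 0"
      by (rule power_eq_0_imp_mpoly_eq_0)
  qed
  moreover have "f \<in> carrier ?R \<and> f [^]\<^bsub>?R\<^esub> (1::nat) \<in> I" if "f \<in> I" for f
    using that ideal.Icarr[OF ideal_I that] by (simp only: R_pow power_one_right simp_thms)
  ultimately have "ideal_radical ?R I = I"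
    unfolding ideal_radical_def by (blast intro: zero_less_one)
  with ideal_I show ?thesis
    unfolding radical_ideal_def assms(5)[symmetric] by blast
qed

end
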